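(* Let $0<p_1<p_2<1$. Let $F$ be any cdf, and let $F_1,F_2,\ldots$ be any sequence of (possibly random) cdf's such that $\sup_{x\in \mathbb{R}} | F_n(x) - F(x)| \stackrel{\mathbb{P}}{\to} 0$ when $n\to \infty$. Then $$\int_{p_1}^{p_2} F_n^{-1}(u)\,du - \int_{p_1}^{p_2}F^{-1}(u)\, du =\int_{F^{-1}(p_1)}^{F^{-1}(p_2)} \big( F(x)- F_n(x)\big)\, dx +o_{\mathbb{P}}(1)$$ and, therefore, the consistency statement $$\int_{p_1}^{p_2} F_n^{-1}(u)\, du \stackrel{\mathbb{P}}{\to} \int_{p_1}^{p_2} F^{-1}(u)\,du$$ holds if and only if $$\int_{F^{-1}(p_1)}^{F^{-1}(p_2)} F_n(x)\, dx \stackrel{\mathbb{P}}{\to} \int_{F^{-1}(p_1)}^{F^{-1}(p_2)}F(x)\, dx .$$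
   Context: The quantile function of a cdf $F$ is $F^{-1}(u)=\inf\{x\in\mathbb{R}: F(x)\ge u\}$ for $u\in(0,1]$ and $F^{-1}(0)=\lim_{u\downarrow 0}F^{-1}(u)$. The cdf $F$ is deterministic. The $F_n$ may be random: on an underlying probability space $(\Omega,\mathcal{A},\mathbb{P})$, $F_n:\Omega\times\mathbb{R}\to[0,1]$ is jointly measurable and $F_n(\omega,\cdot)$ is a cdf for almost all $\omega$. No particular sampling design or dependence structure is assumed. $\stackrel{\mathbb{P}}{\to}$ denotes convergence in probability, and $o_{\mathbb{P}}(1)$ denotes a term converging to $0$ in probability as $n\to\infty$. *)

theory Defs
  imports "HOL-Probability.Probability"
begin

definition is_cdf :: "(real \<Rightarrow> real) \<Rightarrow> bool" where
  "is_cdf F \<longleftrightarrow> (\<exists>\<mu>. real_distribution \<mu> \<and> F = cdf \<mu>)"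

lemma is_cdf_iff:
  "is_cdf F \<longleftrightarrow>
     mono F \<and> (\<forall>x. continuous (at_right x) F) \<and>
     (F \<longlongrightarrow> 0) at_bot \<and> (F \<longlongrightarrow> 1) at_top"
proof
  assume "is_cdf F"
  then obtain \<mu> where "real_distribution \<mu>" and F: "F = cdf \<mu>"
    by (auto simp: is_cdf_def)
  then interpret real_distribution \<mu> by simp
  show "mono F \<and> (\<forall>x. continuous (at_right x) F) \<and>
     (F \<longlongrightarrow> 0) at_bot \<and> (F \<longlongrightarrow> 1) at_top"
    unfolding F
    using cdf_nondecreasing cdf_is_right_cont cdf_lim_at_bot cdf_lim_at_top_prob
    by (auto simp: mono_def)
next
  assume *: "mono F \<and> (\<forall>x. continuous (at_right x) F) \<and>
     (F \<longlongrightarrow> 0) at_bot \<and> (F \<longlongrightarrow> 1) at_top"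
  then have "real_distribution (interval_measure F)"
    by (intro real_distribution_interval_measure) (auto simp: mono_def)
  moreover have "cdf (interval_measure F) = F"
    using * by (intro cdf_interval_measure) (auto simp: mono_def)
  ultimately show "is_cdf F"
    by (auto simp: is_cdf_def)
qed

text \<open>
  The generalised inverse \<open>F\<^sup>-\<^sup>1(u)\<close>, intended for \<open>u\<close> in \<open>[0,1]\<close>. It takes values in the
  extended reals, so that \<open>F\<^sup>-\<^sup>1(1) = \<infinity>\<close> when \<open>F\<close> does not attain \<open>1\<close> and \<open>F\<^sup>-\<^sup>1(0) = -\<infinity>\<close> when
  \<open>F\<close> is positive everywhere; on \<open>(0,1)\<close> it is finite for every cdf (\<open>quantile_finite\<close>).
\<close>
definition quantile :: "(real \<Rightarrow> real) \<Rightarrow> real \<Rightarrow> ereal" where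
  "quantile F u =
     (if u = 0 then Lim (at_right 0) (\<lambda>v. INF x\<in>{x. F x \<ge> v}. ereal x)
      else INF x\<in>{x. F x \<ge> u}. ereal x)"

lemma quantile_finite:
  assumes "is_cdf F" "0 < u" "u < 1"
  shows "quantile F u = ereal (Inf {x. F x \<ge> u})"
proof -
  have *: "mono F" "(F \<longlongrightarrow> 0) at_bot" "(F \<longlongrightarrow> 1) at_top"
    using assms(1) by (auto simp: is_cdf_iff)
  from order_tendstoD(2)[OF *(2) assms(2)] obtain a where a: "F a < u"
    by (auto simp: eventually_at_bot_linorder)
  from order_tendstoD(1)[OF *(3) assms(3)] obtain b where b: "u < F b"
    by (auto simp: eventually_at_top_linorder)
  have "a \<le> x" if "F x \<ge> u" for x
    using that a monoD[OF *(1), of x a] by linarith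
  then have "bdd_below {x. F x \<ge> u}"
    by (intro bdd_belowI[of _ a]) auto
  moreover have "{x. F x \<ge> u} \<noteq> {}"
    using b by (auto intro: less_imp_le)
  ultimately have "ereal (Inf {x. F x \<ge> u}) = (INF x\<in>{x. F x \<ge> u}. ereal x)"
    by (intro ereal_Inf') auto
  then show ?thesis
    using assms(2) by (simp add: quantile_def)
qed

text \<open>
  Convergence in probability of \<open>X n\<close> to \<open>Y\<close>. The random elements considered here are
  determined by random cdfs only up to a null set of \<open>\<omega>\<close>, on which their measurability is not
  guaranteed. Since \<open>measure\<close> and \<open>emeasure\<close> assign \<open>0\<close> to non-measurable sets, the outer
  measure is used; it agrees with \<open>emeasure\<close> on measurable sets.
\<close>
definition converges_in_prob ::
    "'a measure \<Rightarrow> (nat \<Rightarrow> 'a \<Rightarrow> real) \<Rightarrow> ('a \<Rightarrow> real) \<Rightarrow> bool" where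
  "converges_in_prob M X Y \<longleftrightarrow>
     (\<forall>\<epsilon>>0. (\<lambda>n. outer_measure_of M {\<omega> \<in> space M. \<bar>X n \<omega> - Y \<omega>\<bar> > \<epsilon>}) \<longlonglongrightarrow> 0)"

lemma (in prob_space) converges_in_prob_iff:
  assumes [measurable]: "\<And>n. random_variable borel (X n)" "random_variable borel Y"
  shows "converges_in_prob M X Y \<longleftrightarrow>
     (\<forall>\<epsilon>>0. (\<lambda>n. prob {\<omega> \<in> space M. \<bar>X n \<omega> - Y \<omega>\<bar> > \<epsilon>}) \<longlonglongrightarrow> 0)"
proof -
  have "outer_measure_of M {\<omega> \<in> space M. \<bar>X n \<omega> - Y \<omega>\<bar> > \<epsilon>} =
      ennreal (prob {\<omega> \<in> space M. \<bar>X n \<omega> - Y \<omega>\<bar> > \<epsilon>})" for n \<epsilon>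
    by (subst outer_measure_of_eq) (auto simp: emeasure_eq_measure)
  then show ?thesis
    unfolding converges_in_prob_def
    by (simp add: tendsto_ennreal_iff flip: ennreal_0)
qed

end

theory Submission
  imports Defs
begin

text \<open>
  Let \<open>Q = F\<^sup>-\<^sup>1\<close> and let \<open>c(G)\<close> be \<open>G\<close> clamped to \<open>[p1,p2]\<close>. By Fubini, if \<open>G(a) \<le> p1\<close> and
  \<open>p2 \<le> G(b)\<close>, then the integral of \<open>G\<^sup>-\<^sup>1\<close> over \<open>(p1,p2)\<close> equals \<open>a (p2 - p1)\<close> plus the integral
  of \<open>p2 - c(G)\<close> over \<open>(a,b)\<close>. As \<open>0 < p1\<close> and \<open>p2 < 1\<close>, a single pair \<open>a, b\<close> serves \<open>F\<close> and
  every \<open>G\<close> uniformly close to \<open>F\<close>, so the difference of the quantile integrals is the integral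
  of \<open>c(F) - c(G)\<close>. Clamping is 1-Lipschitz and \<open>c(F) = F\<close> on \<open>[Q(p1), Q(p2))\<close>; hence
  \<open>c(F) - c(G)\<close> differs from \<open>F - G\<close> there, and from \<open>0\<close> elsewhere, by at most \<open>sup |G - F|\<close>, and
  the remainder is at most \<open>(b - a) sup |G - F|\<close>.
\<close>

section \<open>Cdfs and their quantile functions\<close>

lemma is_cdf_borel_measurable: "is_cdf G \<Longrightarrow> G \<in> borel_measurable borel"
  by (auto simp: is_cdf_iff intro: borel_measurable_mono)

lemma is_cdf_exists_less:
  assumes "is_cdf F" "0 < u"
  obtains a where "F a < u"
proof -
  have "(F \<longlongrightarrow> 0) at_bot" using assms(1) by (simp add: is_cdf_iff)
  from order_tendstoD(2)[OF this assms(2)] that show thesis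
    by (auto simp: eventually_at_bot_linorder)
qed

lemma is_cdf_exists_greater:
  assumes "is_cdf F" "u < 1"
  obtains b where "u < F b"
proof -
  have "(F \<longlongrightarrow> 1) at_top" using assms(1) by (simp add: is_cdf_iff)
  from order_tendstoD(1)[OF this assms(2)] that show thesis
    by (auto simp: eventually_at_top_linorder)
qed

text \<open>The set \<open>{x. u \<le> G x}\<close> is upward closed by monotonicity and contains
  its infimum by right-continuity, so it is the closed half-line starting at the quantile. For the
  forward direction, points \<open>y\<close> to the right of \<open>x\<close> are shown to lie in
  the set, and \<open>y\<close> then decreases to \<open>x\<close>.\<close>

lemma quantile_le_iff:
  assumes "is_cdf G" "0 < u" "u < 1"
  shows "quantile G u \<le> ereal x \<longleftrightarrow> u \<le> G x"
proof
  show "quantile G u \<le> ereal x" if "u \<le> G x"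
    using that assms(2) by (auto simp: quantile_def intro: INF_lower)
  assume le: "quantile G u \<le> ereal x"
  have "u \<le> G y" if "x < y" for y
  proof -
    from le that have "(INF z\<in>{z. u \<le> G z}. ereal z) < ereal y"
      using assms(2) by (simp add: quantile_def le_less_trans)
    then obtain z where "u \<le> G z" "z < y"
      by (auto simp: INF_less_iff)
    moreover have "mono G" using assms(1) by (simp add: is_cdf_iff)
    ultimately show ?thesis
      by (meson less_imp_le monoD order_trans)
  qed
  then have "\<forall>\<^sub>F y in at_right x. u \<le> G y"
    by (auto simp: eventually_at_filter)
  moreover have "(G \<longlongrightarrow> G x) (at_right x)"
    using assms(1) by (simp add: is_cdf_iff continuous_within)
  ultimately show "u \<le> G x"
    by (intro tendsto_lowerbound) auto
qed

lemma real_quantile_le_iff: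
  assumes "is_cdf G" "0 < u" "u < 1"
  shows "real_of_ereal (quantile G u) \<le> x \<longleftrightarrow> u \<le> G x"
  using quantile_le_iff[OF assms, of x] quantile_finite[OF assms] by simp

section \<open>Quantile integrals of fixed cdfs\<close>

text \<open>Up to the term \<open>a * (p2 - p1)\<close>, both sides are the area of the part of the
  rectangle \<open>(p1, p2) \<times> (a, b)\<close> where \<open>G x < u\<close>. The conditions at
  \<open>a\<close> and \<open>b\<close> confine the quantile \<open>Q u\<close> to
  \<open>[a, b]\<close>, so the section at \<open>u\<close> is exactly
  \<open>(a, Q u)\<close>.\<close>

lemma integral_quantile_eq_integral_clamp:
  fixes G :: "real \<Rightarrow> real"
  assumes G: "is_cdf G" and p: "0 < p1" "p1 \<le> p2" "p2 < 1"
    and a: "G a \<le> p1" and b: "p2 \<le> G b" and ab: "a \<le> b"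
  shows "(LBINT u=p1..p2. real_of_ereal (quantile G u)) =
    a * (p2 - p1) + (LBINT x:{a<..<b}. p2 - max p1 (min p2 (G x)))"
proof -
  define Q where "Q u = real_of_ereal (quantile G u)" for u
  have Q: "Q u \<le> x \<longleftrightarrow> u \<le> G x" if "u \<in> {p1<..<p2}" for u x
    using real_quantile_le_iff[OF G, of u x] that p by (simp add: Q_def)
  have [measurable]: "G \<in> borel_measurable borel"
    by (rule is_cdf_borel_measurable[OF G])
  define f :: "real \<Rightarrow> real \<Rightarrow> real" where
    "f u x = indicator {p1<..<p2} u * (indicator {a<..<b} x * (if G x < u then 1 else 0))" for u x
  have f_meas: "case_prod f \<in> borel_measurable (lborel \<Otimes>\<^sub>M lborel)"
    unfolding f_def by measurable
  have f_int: "integrable (lborel \<Otimes>\<^sub>M lborel) (case_prod f)"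
  proof (rule Bochner_Integration.integrable_bound[OF _ f_meas])
    have "emeasure (lborel \<Otimes>\<^sub>M lborel) ({p1<..<p2} \<times> {a<..<b}) < \<infinity>"
      using p ab by (subst lborel.emeasure_pair_measure_Times) (auto simp: ennreal_mult_less_top)
    then show "integrable (lborel \<Otimes>\<^sub>M lborel) (indicator ({p1<..<p2} \<times> {a<..<b}) :: _ \<Rightarrow> real)"
      by (intro integrable_real_indicator) auto
    show "AE z in lborel \<Otimes>\<^sub>M lborel. norm (case_prod f z)
        \<le> norm (indicator ({p1<..<p2} \<times> {a<..<b}) z :: real)"
      by (auto simp: f_def indicator_def)
  qed
  have inner_x: "(\<integral>x. f u x \<partial>lborel) = indicator {p1<..<p2} u * (Q u - a)" for u
  proof (cases "u \<in> {p1<..<p2}")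
    case True
    have "a \<le> Q u" "Q u \<le> b"
      using Q[OF True, of a] Q[OF True, of b] a b True by auto
    moreover have "f u x = indicator {a<..<Q u} x" for x
      using Q[OF True, of x] True \<open>Q u \<le> b\<close> by (auto simp: f_def indicator_def)
    ultimately show ?thesis
      using True by simp
  qed (simp add: f_def)
  have inner_u: "(\<integral>u. f u x \<partial>lborel) = indicator {a<..<b} x * (p2 - max p1 (min p2 (G x)))" for x
  proof -
    \<comment> \<open>The section at \<open>x\<close> runs from the clamped value of
      \<open>G x\<close> up to \<open>p2\<close>. Capping at \<open>p2\<close> makes its length 0,
      not negative, when \<open>G x\<close> exceeds \<open>p2\<close>.\<close>
    have "f u x = indicator {a<..<b} x * indicator {max p1 (min p2 (G x))<..<p2} u" for u
      by (auto simp: f_def indicator_def)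
    then show ?thesis using p by simp
  qed
  \<comment> \<open>Integrability of the quantile on \<open>(p1, p2)\<close> comes out of Fubini; it
    justifies splitting off the constant \<open>a\<close> below.\<close>
  have int1: "integrable lborel (\<lambda>u. indicator {p1<..<p2} u * (Q u - a))"
    using lborel_pair.integrable_fst'[OF f_int] by (simp add: inner_x)
  have "(\<integral>u. indicator {p1<..<p2} u * (Q u - a) \<partial>lborel)
      = (\<integral>x. indicator {a<..<b} x * (p2 - max p1 (min p2 (G x))) \<partial>lborel)"
    using lborel_pair.Fubini_integral[OF f_int] by (simp add: inner_x inner_u)
  moreover have "(\<integral>u. indicator {p1<..<p2} u * Q u \<partial>lborel)
      = (\<integral>u. indicator {p1<..<p2} u * (Q u - a) + a * indicator {p1<..<p2} u \<partial>lborel)"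
    by (intro Bochner_Integration.integral_cong) (auto simp: algebra_simps)
  moreover have "\<dots> = (\<integral>u. indicator {p1<..<p2} u * (Q u - a) \<partial>lborel) + a * (p2 - p1)"
    using int1 p by (subst Bochner_Integration.integral_add) auto
  ultimately show ?thesis
    using p by (simp add: interval_lebesgue_integral_def set_lebesgue_integral_def Q_def)
qed

text \<open>The margin \<open>D\<close> at \<open>a\<close> and \<open>b\<close> makes both points
  admissible in the clamp identity for \<open>G\<close> as well as for \<open>F\<close>. The bound
  is deterministic, to be applied for each \<omega> separately.\<close>

lemma quantile_integral_remainder:
  fixes F G :: "real \<Rightarrow> real"
  assumes F: "is_cdf F" and G: "is_cdf G" and p: "0 < p1" "p1 \<le> p2" "p2 < 1"
    and D: "\<And>x. \<bar>G x - F x\<bar> \<le> D"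
    and a: "F a + D < p1" and b: "p2 + D \<le> F b"
  shows "\<bar>(LBINT u=p1..p2. real_of_ereal (quantile G u))
            - (LBINT u=p1..p2. real_of_ereal (quantile F u))
          - (LBINT x=quantile F p1..quantile F p2. F x - G x)\<bar> \<le> D * (b - a)"
proof -
  define c where "c v = max p1 (min p2 v)" for v :: real
  have lip: "\<bar>c v - c w\<bar> \<le> \<bar>w - v\<bar>" for v w
    by (auto simp: c_def max_def min_def)
  have "0 \<le> D" using D[of 0] by linarith
  have mono: "mono F" using F by (simp add: is_cdf_iff)
  have ab: "a \<le> b"
    using a b \<open>0 \<le> D\<close> p monoD[OF mono, of b a] by linarith
  have ends: "F a \<le> p1" "p2 \<le> F b" "G a \<le> p1" "p2 \<le> G b"
    using a b \<open>0 \<le> D\<close> D[of a] D[of b] by linarith+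
  define q1 q2 where "q1 = real_of_ereal (quantile F p1)" and "q2 = real_of_ereal (quantile F p2)"
  have q: "quantile F p1 = ereal q1" "quantile F p2 = ereal q2"
    using quantile_finite[OF F] p by (auto simp: q1_def q2_def)
  have q1: "q1 \<le> x \<longleftrightarrow> p1 \<le> F x" and q2: "q2 \<le> x \<longleftrightarrow> p2 \<le> F x" for x
    using real_quantile_le_iff[OF F] p by (auto simp: q1_def q2_def)
  have q12: "q1 \<le> q2"
    using q1[of q2] q2[of q2] p by simp
  have q_ab: "a < q1" "q2 \<le> b"
    using q1[of a] q2[of b] a \<open>0 \<le> D\<close> ends by linarith+
  have [measurable]: "F \<in> borel_measurable borel" "G \<in> borel_measurable borel"
    using F G by (simp_all add: is_cdf_borel_measurable)
  have [measurable]: "c \<in> borel_measurable borel"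
    unfolding c_def by measurable
  have int: "integrable lborel (\<lambda>x. indicator {l<..<r} x * g x)"
    if [measurable]: "g \<in> borel_measurable borel" and K: "\<And>x. \<bar>g x\<bar> \<le> K"
    for l r K and g :: "real \<Rightarrow> real"
  proof (rule Bochner_Integration.integrable_bound)
    show "integrable lborel (\<lambda>x. K * indicator {l<..<r} x)"
      by (cases "l \<le> r") auto
    show "AE x in lborel. norm (indicator {l<..<r} x * g x) \<le> norm (K * indicator {l<..<r} x)"
      using order_trans[OF K abs_ge_self] by (intro AE_I2) (simp add: indicator_def)
  qed measurable
  have c_bounds: "p1 \<le> c v" "c v \<le> p2" for v
    using p by (auto simp: c_def)
  have int_p2c: "integrable lborel (\<lambda>x. indicator {a<..<b} x * (p2 - c (H x)))"
    if "H \<in> borel_measurable borel" for H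
    using that c_bounds by (intro int[where K = "p2 - p1"]) auto
  have int_FG: "integrable lborel (\<lambda>x. indicator {q1<..<q2} x * (F x - G x))"
    using D by (intro int[where K = D]) (auto simp: abs_minus_commute)
  \<comment> \<open>The integrand of the whole remainder: \<open>p2\<close> cancels on
    \<open>(a, b)\<close>, leaving \<open>c (F x) - c (G x)\<close> there, minus
    \<open>F x - G x\<close> on \<open>(q1, q2)\<close>.\<close>
  define h where "h x = indicator {a<..<b} x * (p2 - c (G x)) - indicator {a<..<b} x * (p2 - c (F x))
      - indicator {q1<..<q2} x * (F x - G x)" for x
  have h_int: "integrable lborel h"
    unfolding h_def by (intro Bochner_Integration.integrable_diff int_p2c int_FG) measurable
  have h_le: "\<bar>h x\<bar> \<le> D * indicator {a<..<b} x" for x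
  proof (cases "x \<in> {q1<..<q2}")
    case True
    then have "c (F x) = F x"
      using q1[of x] q2[of x] by (auto simp: c_def)
    \<comment> \<open>Here \<open>h x\<close> reduces to \<open>G x - c (G x)\<close>. As
      \<open>c\<close> projects onto \<open>[p1, p2]\<close>, which contains \<open>F x\<close>, it
      moves \<open>G x\<close> no farther than the distance to \<open>F x\<close>.\<close>
    moreover have "\<bar>G x - c (G x)\<bar> \<le> \<bar>G x - F x\<bar>"
      using q1[of x] q2[of x] True by (auto simp: c_def max_def min_def)
    moreover have "x \<in> {a<..<b}"
      using True q_ab by auto
    ultimately show ?thesis
      using True D[of x] by (simp add: h_def)
  next
    case False
    have "\<bar>c (F x) - c (G x)\<bar> \<le> D"
      using lip[of "F x" "G x"] D[of x] by linarith
    with False \<open>0 \<le> D\<close> show ?thesis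
      by (auto simp: h_def indicator_def)
  qed
  \<comment> \<open>The same \<open>a\<close> and \<open>b\<close> serve \<open>G\<close> and
    \<open>F\<close>, so the terms \<open>a * (p2 - p1)\<close> cancel.\<close>
  have "(LBINT u=p1..p2. real_of_ereal (quantile G u))
            - (LBINT u=p1..p2. real_of_ereal (quantile F u))
          - (LBINT x=quantile F p1..quantile F p2. F x - G x)
      = (\<integral>x. indicator {a<..<b} x * (p2 - c (G x)) \<partial>lborel)
        - (\<integral>x. indicator {a<..<b} x * (p2 - c (F x)) \<partial>lborel)
        - (\<integral>x. indicator {q1<..<q2} x * (F x - G x) \<partial>lborel)"
    using integral_quantile_eq_integral_clamp[OF G p ends(3,4) ab]
      integral_quantile_eq_integral_clamp[OF F p ends(1,2) ab] q12
    by (simp add: q c_def interval_lebesgue_integral_def[of _ "ereal q1"] set_lebesgue_integral_def)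
  also have "\<dots> = (\<integral>x. h x \<partial>lborel)"
    unfolding h_def using int_p2c int_FG by (subst Bochner_Integration.integral_diff; simp)+
  also have "\<bar>\<dots>\<bar> \<le> (\<integral>x. D * indicator {a<..<b} x \<partial>lborel)"
    using h_int h_le ab by (intro integral_abs_bound[THEN order_trans] integral_mono) auto
  also have "\<dots> = D * (b - a)"
    using ab by simp
  finally show ?thesis .
qed

section \<open>Passage to convergence in probability\<close>

text \<open>Union bound: off a null set, a deviation of \<open>Z n\<close> beyond \<epsilon> forces
  one of \<open>X n\<close> or \<open>Y n\<close> beyond \<eta>. Since \<eta> does not depend on
  \<open>n\<close>, the sum of the two outer measures tends to 0.\<close>

lemma converges_in_prob_dominated:
  assumes X: "converges_in_prob M X X'" and Y: "converges_in_prob M Y Y'"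
    and dom: "\<And>\<epsilon>. 0 < \<epsilon> \<Longrightarrow> \<exists>\<eta>>0. \<forall>n. AE \<omega> in M.
      \<bar>X n \<omega> - X' \<omega>\<bar> \<le> \<eta> \<longrightarrow> \<bar>Y n \<omega> - Y' \<omega>\<bar> \<le> \<eta> \<longrightarrow> \<bar>Z n \<omega> - Z' \<omega>\<bar> \<le> \<epsilon>"
  shows "converges_in_prob M Z Z'"
  unfolding converges_in_prob_def
proof (intro allI impI)
  \<comment> \<open>The sets may fail to be measurable, so each is replaced by a measurable superset
    of the same outer measure.\<close>
  have subadd: "outer_measure_of M (A \<union> B) \<le> outer_measure_of M A + outer_measure_of M B"
    if AB: "A \<subseteq> space M" "B \<subseteq> space M" for A B
  proof -
    obtain A' B' where "A' \<in> sets M" "A \<subseteq> A'" "outer_measure_of M A = emeasure M A'"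
      "B' \<in> sets M" "B \<subseteq> B'" "outer_measure_of M B = emeasure M B'"
      using AB outer_measure_of_attain by metis
    then show ?thesis
      using outer_measure_of_mono[of "A \<union> B" "A' \<union> B'" M] emeasure_subadditive[of A' M B']
      by (auto intro: order_trans)
  qed
  fix \<epsilon> :: real assume "0 < \<epsilon>"
  from dom[OF this] obtain \<eta> where "0 < \<eta>" and \<eta>: "\<And>n. AE \<omega> in M.
      \<bar>X n \<omega> - X' \<omega>\<bar> \<le> \<eta> \<longrightarrow> \<bar>Y n \<omega> - Y' \<omega>\<bar> \<le> \<eta> \<longrightarrow> \<bar>Z n \<omega> - Z' \<omega>\<bar> \<le> \<epsilon>"
    by blast
  define a b where
    "a n = {\<omega> \<in> space M. \<bar>X n \<omega> - X' \<omega>\<bar> > \<eta>}" and "b n = {\<omega> \<in> space M. \<bar>Y n \<omega> - Y' \<omega>\<bar> > \<eta>}" for n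
  have lim: "(\<lambda>n. outer_measure_of M (a n) + outer_measure_of M (b n)) \<longlonglongrightarrow> 0 + 0"
    using X Y \<open>0 < \<eta>\<close> unfolding converges_in_prob_def a_def b_def by (intro tendsto_add) auto
  have le: "outer_measure_of M {\<omega> \<in> space M. \<bar>Z n \<omega> - Z' \<omega>\<bar> > \<epsilon>}
      \<le> outer_measure_of M (a n) + outer_measure_of M (b n)" for n
  proof -
    obtain N where sub: "{\<omega> \<in> space M.
        \<not> (\<bar>X n \<omega> - X' \<omega>\<bar> \<le> \<eta> \<longrightarrow> \<bar>Y n \<omega> - Y' \<omega>\<bar> \<le> \<eta> \<longrightarrow> \<bar>Z n \<omega> - Z' \<omega>\<bar> \<le> \<epsilon>)} \<subseteq> N"
      and N: "emeasure M N = 0" "N \<in> sets M"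
      by (rule AE_E[OF \<eta>[of n]])
    have "outer_measure_of M {\<omega> \<in> space M. \<bar>Z n \<omega> - Z' \<omega>\<bar> > \<epsilon>}
        \<le> outer_measure_of M (N \<union> (a n \<union> b n))"
      using sub by (intro outer_measure_of_mono) (force simp: a_def b_def)
    also have "\<dots> \<le> outer_measure_of M N + outer_measure_of M (a n \<union> b n)"
      using N by (intro subadd) (auto simp: a_def b_def dest: sets.sets_into_space)
    also have "\<dots> \<le> outer_measure_of M (a n) + outer_measure_of M (b n)"
      using N subadd[of "a n" "b n"] by (auto simp: a_def b_def)
    finally show ?thesis .
  qed
  show "(\<lambda>n. outer_measure_of M {\<omega> \<in> space M. \<bar>Z n \<omega> - Z' \<omega>\<bar> > \<epsilon>}) \<longlonglongrightarrow> 0"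
    using tendsto_sandwich[OF _ _ tendsto_const lim[unfolded add_0]] le by simp
qed

theorem corollary6p1:
  fixes M :: "'a measure"
    and F :: "real \<Rightarrow> real"
    and Fn :: "nat \<Rightarrow> 'a \<Rightarrow> real \<Rightarrow> real"
    and p1 p2 :: real
  assumes "prob_space M"
    and "0 < p1" and "p1 < p2" and "p2 < 1"
    and "is_cdf F"
    and "\<And>n \<omega> x. \<omega> \<in> space M \<Longrightarrow> Fn n \<omega> x \<in> {0..1}"
    and "\<And>n. (\<lambda>(\<omega>, x). Fn n \<omega> x) \<in> borel_measurable (M \<Otimes>\<^sub>M borel)"
    and "\<And>n. AE \<omega> in M. is_cdf (Fn n \<omega>)"
    and "converges_in_prob M (\<lambda>n \<omega>. SUP x. \<bar>Fn n \<omega> x - F x\<bar>) (\<lambda>\<omega>. 0)"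
  shows
    "converges_in_prob M
       (\<lambda>n \<omega>. ((LBINT u=p1..p2. real_of_ereal (quantile (Fn n \<omega>) u))
                - (LBINT u=p1..p2. real_of_ereal (quantile F u)))
              - (LBINT x=quantile F p1..quantile F p2. F x - Fn n \<omega> x))
       (\<lambda>\<omega>. 0)
     \<and>
     (converges_in_prob M
        (\<lambda>n \<omega>. LBINT u=p1..p2. real_of_ereal (quantile (Fn n \<omega>) u))
        (\<lambda>\<omega>. LBINT u=p1..p2. real_of_ereal (quantile F u))
      \<longleftrightarrow>
      converges_in_prob M
        (\<lambda>n \<omega>. LBINT x=quantile F p1..quantile F p2. Fn n \<omega> x)
        (\<lambda>\<omega>. LBINT x=quantile F p1..quantile F p2. F x))"
proof -
  interpret prob_space M by fact
  note p = assms(2-4) and F = assms(5) and range = assms(6) and meas = assms(7)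
    and cdf = assms(8) and conv = assms(9)
  define A where "A n \<omega> = (LBINT u=p1..p2. real_of_ereal (quantile (Fn n \<omega>) u))" for n \<omega>
  define A' where "A' = (LBINT u=p1..p2. real_of_ereal (quantile F u))"
  define B where "B n \<omega> = (LBINT x=quantile F p1..quantile F p2. Fn n \<omega> x)" for n \<omega>
  define B' where "B' = (LBINT x=quantile F p1..quantile F p2. F x)"
  define C where "C n \<omega> = (LBINT x=quantile F p1..quantile F p2. F x - Fn n \<omega> x)" for n \<omega>
  have F01: "F x \<in> {0..1}" for x
  proof -
    obtain \<mu> where "real_distribution \<mu>" and "F = Distribution_Functions.cdf \<mu>"
      using F by (auto simp: is_cdf_def)
    then interpret \<mu>: real_distribution \<mu> by simp
    show ?thesis
      by (simp add: \<open>F = _\<close> cdf_def)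
  qed
  \<comment> \<open>A real \<open>SUP\<close> is known to be an upper bound only for a bounded
    family; values in \<open>[0, 1]\<close> supply the bound 1.\<close>
  have sup: "\<bar>Fn n \<omega> x - F x\<bar> \<le> (SUP x. \<bar>Fn n \<omega> x - F x\<bar>)" if "\<omega> \<in> space M" for n \<omega> x
  proof (rule cSUP_upper)
    show "bdd_above (range (\<lambda>x. \<bar>Fn n \<omega> x - F x\<bar>))"
    proof (rule bdd_aboveI2)
      show "\<bar>Fn n \<omega> x - F x\<bar> \<le> 1" for x
        using range[OF that, of n x] F01[of x] by auto
    qed
  qed simp
  \<comment> \<open>The integral of the difference splits because both integrands are bounded and
    measurable and the quantiles at \<open>p1\<close> and \<open>p2\<close> are finite.
    Measurability of \<open>Fn n \<omega>\<close> is that of a section of a jointly measurable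
    function.\<close>
  have C: "C n \<omega> = B' - B n \<omega>" if \<omega>: "\<omega> \<in> space M" for n \<omega>
  proof -
    have int: "interval_lebesgue_integrable lborel (quantile F p1) (quantile F p2) g"
      if g: "g \<in> borel_measurable borel" "\<And>x. g x \<in> {0..1}" for g :: "real \<Rightarrow> real"
    proof -
      obtain q1 q2 where q: "quantile F p1 = ereal q1" "quantile F p2 = ereal q2"
        using quantile_finite[OF F] p by auto
      have "set_integrable lborel {l<..<r} g" for l r
        unfolding set_integrable_def
      proof (rule Bochner_Integration.integrable_bound)
        show "integrable lborel (indicator {l<..<r} :: real \<Rightarrow> real)"
          by (cases "l \<le> r") (auto intro!: integrable_real_indicator)
        show "(\<lambda>x. indicator {l<..<r} x *\<^sub>R g x) \<in> borel_measurable lborel"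
          using g(1) by simp
        show "AE x in lborel. norm (indicator {l<..<r} x *\<^sub>R g x)
            \<le> norm (indicator {l<..<r} x :: real)"
          using g(2) by (auto simp: indicator_def)
      qed
      then show ?thesis
        by (simp add: interval_lebesgue_integrable_def q)
    qed
    have "Fn n \<omega> \<in> borel_measurable borel"
      using measurable_compose[OF measurable_Pair1'[OF \<omega>] meas[of n]] by simp
    then show ?thesis
      unfolding B_def B'_def C_def
      using int[of F] int[of "Fn n \<omega>"] F01 range[OF \<omega>] is_cdf_borel_measurable[OF F] by simp
  qed
  \<comment> \<open>Both points are chosen from \<open>F\<close> alone, hence are the same for all
    \<open>n\<close> and \<omega>.\<close>
  obtain a b where a: "F a < p1" and b: "p2 < F b"
    using is_cdf_exists_less[OF F] is_cdf_exists_greater[OF F] p by metis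
  have R: "converges_in_prob M (\<lambda>n \<omega>. (A n \<omega> - A') - C n \<omega>) (\<lambda>\<omega>. 0)"
  \<comment> \<open>The uniform distance alone controls the remainder, so it fills both slots of the
    domination lemma.\<close>
  proof (rule converges_in_prob_dominated[OF conv conv])
    fix \<epsilon> :: real assume "0 < \<epsilon>"
    \<comment> \<open>The first two bounds give \<open>F a + \<eta> < p1\<close> (the half keeps it
      strict) and \<open>p2 + \<eta> \<le> F b\<close>; the third gives
      \<open>\<eta> * (b - a) \<le> \<epsilon>\<close>, the added 1 keeping the denominator
      positive.\<close>
    define \<eta> where "\<eta> = Min {(p1 - F a) / 2, F b - p2, \<epsilon> / (\<bar>b - a\<bar> + 1)}"
    have "0 < \<eta>"
      using a b \<open>0 < \<epsilon>\<close> by (simp add: \<eta>_def)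
    have \<eta>: "\<eta> \<le> (p1 - F a) / 2" "\<eta> \<le> F b - p2" "\<eta> \<le> \<epsilon> / (\<bar>b - a\<bar> + 1)"
      unfolding \<eta>_def by (rule Min_le; simp)+
    have "\<eta> * (b - a) \<le> \<eta> * (\<bar>b - a\<bar> + 1)"
      using \<open>0 < \<eta>\<close> by (intro mult_left_mono) auto
    also have "\<dots> \<le> \<epsilon>"
      using \<eta>(3) by (simp add: field_simps)
    finally have \<epsilon>: "\<eta> * (b - a) \<le> \<epsilon>" .
    have "AE \<omega> in M. \<bar>(SUP x. \<bar>Fn n \<omega> x - F x\<bar>) - 0\<bar> \<le> \<eta>
        \<longrightarrow> \<bar>(SUP x. \<bar>Fn n \<omega> x - F x\<bar>) - 0\<bar> \<le> \<eta> \<longrightarrow> \<bar>(A n \<omega> - A') - C n \<omega> - 0\<bar> \<le> \<epsilon>" for n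
      using cdf[of n] AE_space
    proof eventually_elim
      case (elim \<omega>)
      have "\<bar>(A n \<omega> - A') - C n \<omega>\<bar> \<le> \<epsilon>" if "(SUP x. \<bar>Fn n \<omega> x - F x\<bar>) \<le> \<eta>"
      proof -
        have "\<bar>Fn n \<omega> x - F x\<bar> \<le> \<eta>" for x
          using sup[OF elim(2), of n x] that by linarith
        then have "\<bar>(A n \<omega> - A') - C n \<omega>\<bar> \<le> \<eta> * (b - a)"
          unfolding A_def A'_def C_def using elim(1) F p \<eta>(1,2) a
          by (intro quantile_integral_remainder) auto
        then show ?thesis using \<epsilon> by linarith
      qed
      then show ?case by auto
    qed
    then show "\<exists>\<eta>>0. \<forall>n. AE \<omega> in M. \<bar>(SUP x. \<bar>Fn n \<omega> x - F x\<bar>) - 0\<bar> \<le> \<eta>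
        \<longrightarrow> \<bar>(SUP x. \<bar>Fn n \<omega> x - F x\<bar>) - 0\<bar> \<le> \<eta> \<longrightarrow> \<bar>(A n \<omega> - A') - C n \<omega> - 0\<bar> \<le> \<epsilon>"
      using \<open>0 < \<eta>\<close> by blast
  qed
  \<comment> \<open>By \<open>C n \<omega> = B' - B n \<omega>\<close>, the remainder is the sum of
    \<open>A n \<omega> - A'\<close> and \<open>B n \<omega> - B'\<close>. If it and one summand are
    at most \<open>\<epsilon> / 2\<close> in absolute value, the other summand is at most
    \<epsilon>.\<close>
  have "converges_in_prob M A (\<lambda>_. A') \<longleftrightarrow> converges_in_prob M B (\<lambda>_. B')"
  proof
    assume "converges_in_prob M A (\<lambda>_. A')"
    from R this show "converges_in_prob M B (\<lambda>_. B')"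
    proof (rule converges_in_prob_dominated)
      fix \<epsilon> :: real assume "0 < \<epsilon>"
      have "\<bar>B n \<omega> - B'\<bar> \<le> \<epsilon>"
        if "\<omega> \<in> space M" "\<bar>(A n \<omega> - A') - C n \<omega> - 0\<bar> \<le> \<epsilon> / 2" "\<bar>A n \<omega> - A'\<bar> \<le> \<epsilon> / 2" for n \<omega>
        using that C[OF that(1), of n] by linarith
      with \<open>0 < \<epsilon>\<close> show "\<exists>\<eta>>0. \<forall>n. AE \<omega> in M. \<bar>(A n \<omega> - A') - C n \<omega> - 0\<bar> \<le> \<eta>
          \<longrightarrow> \<bar>A n \<omega> - A'\<bar> \<le> \<eta> \<longrightarrow> \<bar>B n \<omega> - B'\<bar> \<le> \<epsilon>"
        by (intro exI[of _ "\<epsilon> / 2"] conjI allI AE_I2 impI) simp_all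
    qed
  next
    assume "converges_in_prob M B (\<lambda>_. B')"
    from R this show "converges_in_prob M A (\<lambda>_. A')"
    proof (rule converges_in_prob_dominated)
      fix \<epsilon> :: real assume "0 < \<epsilon>"
      have "\<bar>A n \<omega> - A'\<bar> \<le> \<epsilon>"
        if "\<omega> \<in> space M" "\<bar>(A n \<omega> - A') - C n \<omega> - 0\<bar> \<le> \<epsilon> / 2" "\<bar>B n \<omega> - B'\<bar> \<le> \<epsilon> / 2" for n \<omega>
        using that C[OF that(1), of n] by linarith
      with \<open>0 < \<epsilon>\<close> show "\<exists>\<eta>>0. \<forall>n. AE \<omega> in M. \<bar>(A n \<omega> - A') - C n \<omega> - 0\<bar> \<le> \<eta>
          \<longrightarrow> \<bar>B n \<omega> - B'\<bar> \<le> \<eta> \<longrightarrow> \<bar>A n \<omega> - A'\<bar> \<le> \<epsilon>"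
        by (intro exI[of _ "\<epsilon> / 2"] conjI allI AE_I2 impI) simp_all
    qed
  qed
  with R show ?thesis
    unfolding A_def A'_def B_def B'_def C_def by blast
qed

end
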